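(* For every integer $n\ge1$, the polynomial $p_n(z;x,y)$ is the determinant of the $y$-circulant $n\times n$ matrix $$\mathrm{Circ}_y\Bigl(w^n+(-1)^{n+1}x+y,\ \tbinom n1 w,\ \tbinom n2w^2,\ \dots,\ \tbinom n{n-1}w^{n-1}\Bigr),$$ where $w^n=z$.
   Context: Let $\epsilon$ be a primitive $n$-th root of unity. The $n$-valued group $\mathbb{G}_n$ is $\mathbb{C}$ with the $n$-valued multiplication $x\ast y=[(\sqrt[n]{x}+\epsilon^r\sqrt[n]{y})^n\mid r=1,\dots,n]$ and inverse $\mathrm{inv}(x)=(-1)^nx$. The polynomial $p_n$ is defined by $p_n(z;x,y)=\prod_{w'\in\mathrm{inv}(x)\ast\mathrm{inv}(y)}(z-w')$ (product over the $n$-multiset); equivalently $p_n(z;x,y)=\prod_{r,s=1}^n(\sqrt[n]{z}+\epsilon^r\sqrt[n]{x}+\epsilon^s\sqrt[n]{y})$. For a variable $\theta$, the $\theta$-circulant is the matrix obtained from a circulant by multiplying all entries above the diagonal by $\theta$: $$\mathrm{Circ}_\theta(a_0,\dots,a_{n-1})=\begin{pmatrix} a_0 & \theta a_1 & \theta a_2 & \cdots & \theta a_{n-1} \\ a_{n-1} & a_0 & \theta a_1 & \ddots & \vdots \\ a_{n-2} & a_{n-1} & a_0 & \ddots & \theta a_2 \\ \vdots & \ddots & \ddots & \ddots & \theta a_1 \\ a_1 & \cdots & a_{n-2} & a_{n-1} & a_0 \end{pmatrix}.$$ (The matrix in the claim is called the Wendt $(x,y,z)$-matrix.) *)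

theory Defs
  imports Complex_Main "HOL-Library.Multiset" "Jordan_Normal_Form.Determinant"
begin

definition primitive_unity_root :: "nat \<Rightarrow> complex \<Rightarrow> bool" where
  "primitive_unity_root n e \<longleftrightarrow> e ^ n = 1 \<and> (\<forall>k. 0 < k \<and> k < n \<longrightarrow> e ^ k \<noteq> 1)"

(* An unspecified n-th root, which exists for n > 0.  Replacing a root by another one only
   permutes the n-multiset in nval_mult. *)
definition some_nth_root :: "nat \<Rightarrow> complex \<Rightarrow> complex" where
  "some_nth_root n x = (SOME u. u ^ n = x)"

definition nval_mult :: "nat \<Rightarrow> complex \<Rightarrow> complex \<Rightarrow> complex \<Rightarrow> complex multiset" where
  "nval_mult n e x y =
     {# (some_nth_root n x + e ^ r * some_nth_root n y) ^ n. r \<in># mset_set {1..n} #}"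

definition nval_inv :: "nat \<Rightarrow> complex \<Rightarrow> complex" where
  "nval_inv n x = (-1) ^ n * x"

(* The polynomial p_n(z; x, y), given by its values; e is the chosen primitive n-th root of unity. *)
definition nval_poly :: "nat \<Rightarrow> complex \<Rightarrow> complex \<Rightarrow> complex \<Rightarrow> complex \<Rightarrow> complex" where
  "nval_poly n e z x y = (\<Prod>v \<in># nval_mult n e (nval_inv n x) (nval_inv n y). z - v)"

definition circulant :: "nat \<Rightarrow> (nat \<Rightarrow> 'a) \<Rightarrow> 'a mat" where
  "circulant n a = mat n n (\<lambda>(i, j). a ((n + j - i) mod n))"

definition theta_circulant :: "'a::times \<Rightarrow> nat \<Rightarrow> (nat \<Rightarrow> 'a) \<Rightarrow> 'a mat" where
  "theta_circulant \<theta> n a =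
     mat n n (\<lambda>(i, j). if i < j then \<theta> * circulant n a $$ (i, j) else circulant n a $$ (i, j))"

end

theory Submission
  imports Defs "HOL-Computational_Algebra.Polynomial"
begin

text \<open>For $\lambda^n = \theta$ the row vector $(1, \lambda, \dots, \lambda^{n-1})$ is a left
  eigenvector of every \<open>\<theta>\<close>-circulant, with eigenvalue
  $a_0 + \sum_{0<k<n} a_k \lambda^{n-k}$. The \<open>n\<close>-th roots of \<open>\<theta> \<noteq> 0\<close> thus diagonalise the
  matrix, while for \<open>\<theta> = 0\<close> it is lower triangular. For the Wendt matrix the binomial
  theorem turns the eigenvalues into $(w + \lambda)^n - (-1)^n x$. Their product agrees with $p_n$
  because both sides factor into the linear forms $w - \epsilon^s u - \epsilon^r v$, where
  $u^n = (-1)^n x$ and $v^n = (-1)^n y$.\<close>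

lemma primitive_unity_root_power_power:
  assumes "primitive_unity_root n e"
  shows "(e ^ k) ^ n = 1"
proof -
  have "(e ^ k) ^ n = (e ^ n) ^ k"
    by (simp only: power_mult[symmetric] mult.commute)
  then show ?thesis
    using assms by (simp add: primitive_unity_root_def)
qed

lemma primitive_unity_root_inj:
  assumes "primitive_unity_root n e"
  shows "inj_on (\<lambda>r. e ^ r) {1..n}"
proof -
  \<comment> \<open>Starting the range at 1 keeps \<open>j - i\<close> strictly between 0 and
    \<open>n\<close>, where primitivity applies.\<close>
  have *: "e ^ i \<noteq> e ^ j" if "1 \<le> i" "i < j" "j \<le> n" for i j
  proof
    assume eq: "e ^ i = e ^ j"
    have "e \<noteq> 0"
      using assms that by (auto simp: primitive_unity_root_def power_0_left split: if_splits)
    moreover have "e ^ j = e ^ i * e ^ (j - i)"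
      using that by (simp flip: power_add)
    ultimately have "e ^ (j - i) = 1"
      using eq by simp
    moreover have "e ^ (j - i) \<noteq> 1"
      using assms that by (auto simp: primitive_unity_root_def)
    ultimately show False by simp
  qed
  show ?thesis
  proof (rule inj_onI)
    fix i j assume "i \<in> {1..n}" "j \<in> {1..n}" "e ^ i = e ^ j"
    then show "i = j"
      using *[of i j] *[of j i] by (cases i j rule: linorder_cases) auto
  qed
qed

text \<open>Seen as polynomials in \<open>a\<close>, both sides are monic of degree \<open>n\<close>
  and vanish at the points \<open>e ^ s * b\<close>, which are distinct for
  \<open>b \<noteq> 0\<close>. The final computation uses this in both directions, to split and to
  merge products.\<close>

lemma power_diff_eq_prod_unity_roots:
  assumes n: "n \<ge> 1" and e: "primitive_unity_root n e"
  shows "a ^ n - b ^ n = (\<Prod>s\<in>{1..n}. a - e ^ s * b)"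
proof (cases "b = 0")
  case True
  then show ?thesis using n by (simp add: power_0_left)
next
  case False
  define p where "p = monom 1 n - [:b ^ n:]"
  define q where "q = (\<Prod>s\<in>{1..n}. [:- (e ^ s * b), 1:])"
  have "degree p = n \<and> coeff p n = 1"
  proof -
    have "degree p = degree (monom (1 :: complex) n)"
      unfolding p_def diff_conv_add_uminus
      by (rule degree_add_eq_left) (use n in \<open>simp add: degree_monom_eq\<close>)
    with n show ?thesis by (simp add: p_def degree_monom_eq coeff_pCons split: nat.split)
  qed
  moreover have "degree q = n"
    unfolding q_def by (subst degree_prod_eq_sum_degree) auto
  moreover have "lead_coeff q = 1"
    unfolding q_def lead_coeff_prod by simp
  moreover have "card ((\<lambda>s. e ^ s * b) ` {1..n}) = n"
  proof -
    have "inj_on (\<lambda>s. e ^ s * b) {1..n}"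
      by (rule inj_onI) (use False inj_onD[OF primitive_unity_root_inj[OF e]] in simp)
    then show ?thesis by (simp add: card_image)
  qed
  moreover have "poly p c = poly q c" if "c \<in> (\<lambda>s. e ^ s * b) ` {1..n}" for c
  proof -
    from that obtain s where s: "s \<in> {1..n}" "c = e ^ s * b" by auto
    have "c ^ n = b ^ n"
      by (simp only: s(2) power_mult_distrib primitive_unity_root_power_power[OF e] mult_1)
    then have "poly p c = 0" by (simp add: p_def poly_monom)
    moreover have "poly q c = 0" using s by (auto simp: q_def poly_prod)
    ultimately show ?thesis by simp
  qed
  ultimately have "p = q"
    \<comment> \<open>Equal leading terms leave a difference of degree below \<open>n\<close>, so
      \<open>n\<close> common values suffice.\<close>
    by (intro poly_eqI_degree_lead_coeff[where n = n and A = "(\<lambda>s. e ^ s * b) ` {1..n}"]) auto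
  then have "poly p a = poly q a" by simp
  then show ?thesis by (simp add: p_def q_def poly_monom poly_prod)
qed

text \<open>Up to the factor \<open>n\<close>, this Vandermonde matrix is inverted by the matrix of
  inverse powers, as for the discrete Fourier transform; characteristic 0 keeps \<open>n ^ n\<close>
  nonzero.\<close>

lemma det_vandermonde_roots_nonzero:
  fixes l :: "nat \<Rightarrow> 'a::field_char_0"
  assumes n: "n \<ge> 1" and \<theta>: "\<theta> \<noteq> 0" and roots: "\<And>i. i < n \<Longrightarrow> l i ^ n = \<theta>"
    and inj: "inj_on l {..<n}"
  shows "det (mat n n (\<lambda>(i, j). l i ^ j)) \<noteq> 0"
proof
  define F where "F = mat n n (\<lambda>(i, j). l i ^ j)"
  define G where "G = mat n n (\<lambda>(j, k). inverse (l k) ^ j)"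
  have nz: "l i \<noteq> 0" if "i < n" for i
    using roots[OF that] \<theta> n by (auto simp: power_0_left)
  have "F * G = of_nat n \<cdot>\<^sub>m 1\<^sub>m n"
  proof (rule eq_matI)
    fix i k assume "i < dim_row (of_nat n \<cdot>\<^sub>m 1\<^sub>m n :: 'a mat)"
      and "k < dim_col (of_nat n \<cdot>\<^sub>m 1\<^sub>m n :: 'a mat)"
    then have ik: "i < n" "k < n" by auto
    have "(F * G) $$ (i, k) = (\<Sum>j<n. (l i / l k) ^ j)"
      using ik by (simp add: F_def G_def scalar_prod_def atLeast0LessThan
        divide_inverse power_mult_distrib)
    also have "\<dots> = (if i = k then of_nat n else 0)"
    proof (cases "i = k")
      case False
      \<comment> \<open>The ratio is an \<open>n\<close>-th root of unity other than 1, so its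
        geometric sum vanishes.\<close>
      then have "l i / l k \<noteq> 1" using inj ik nz by (auto simp: inj_on_def)
      moreover have "(l i / l k) ^ n = 1" using roots ik \<theta> by (simp add: power_divide)
      ultimately show ?thesis using False by (simp add: geometric_sum)
    qed (use nz ik in simp)
    finally show "(F * G) $$ (i, k) = (of_nat n \<cdot>\<^sub>m 1\<^sub>m n) $$ (i, k)" using ik by simp
  qed (auto simp: F_def G_def)
  then have "det F * det G = of_nat n ^ n"
    by (subst det_mult[symmetric, of _ n]) (auto simp: F_def G_def)
  moreover assume "det (mat n n (\<lambda>(i, j). l i ^ j)) = 0"
  ultimately show False using n by (simp add: F_def)
qed

text \<open>Above the diagonal the factor \<open>\<theta> = l ^ n\<close> makes up for the
  wrap-around of the index, so \<open>a k\<close> always enters column \<open>j\<close> with weight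
  \<open>l ^ (n - k) * l ^ j\<close>. Only the diagonal entry \<open>a 0\<close> has weight
  \<open>l ^ j\<close>.\<close>

lemma theta_circulant_left_eigenvector:
  fixes l :: "'a::comm_ring_1"
  assumes j: "j < n" and l: "l ^ n = \<theta>"
  shows "(\<Sum>i<n. l ^ i * theta_circulant \<theta> n a $$ (i, j)) =
    (a 0 + (\<Sum>k=1..<n. a k * l ^ (n - k))) * l ^ j"
proof -
  define g where "g k = (if k = 0 then a 0 else a k * l ^ (n - k))" for k
  have entry: "l ^ i * theta_circulant \<theta> n a $$ (i, j) = g ((n + j - i) mod n) * l ^ j"
    if "i < n" for i
  proof (cases i j rule: linorder_cases)
    case less
    then have "(n + j - i) mod n = j - i"
      using j by (metis Nat.add_diff_assoc less_imp_diff_less less_imp_le_nat mod_add_self1 mod_less)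
    moreover have "i + n = n - (j - i) + j" using less j by simp
    then have "l ^ i * \<theta> = l ^ (n - (j - i)) * l ^ j"
      by (simp flip: l power_add)
    then have "l ^ i * (\<theta> * a (j - i)) = a (j - i) * l ^ (n - (j - i)) * l ^ j"
      by (metis mult.assoc mult.commute)
    ultimately show ?thesis
      using less j that by (simp add: theta_circulant_def circulant_def g_def)
  next
    case equal
    then show ?thesis using j by (simp add: theta_circulant_def circulant_def g_def)
  next
    case greater
    then have "(n + j - i) mod n = n + j - i" using that by simp
    moreover have "i = n - (n + j - i) + j" using greater that by simp
    then have "l ^ i = l ^ (n - (n + j - i)) * l ^ j"
      by (metis power_add)
    ultimately show ?thesis
      using greater j that by (simp add: theta_circulant_def circulant_def g_def mult_ac)
  qed
  \<comment> \<open>Reflection of indices modulo \<open>n\<close> is an involution, hence its own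
    inverse in the reindexing below.\<close>
  have inv: "(n + j - (n + j - i) mod n) mod n = i" if "i < n" for i
  proof (cases "i \<le> j")
    case True
    then have "(n + j - i) mod n = j - i"
      using j by (metis Nat.add_diff_assoc less_imp_diff_less mod_add_self1 mod_less)
    then show ?thesis using True that by simp
  next
    case False
    then show ?thesis using that by simp
  qed
  have "(\<Sum>i<n. l ^ i * theta_circulant \<theta> n a $$ (i, j)) =
      (\<Sum>i<n. g ((n + j - i) mod n) * l ^ j)"
    using entry by simp
  also have "\<dots> = (\<Sum>k<n. g k * l ^ j)"
    using j inv
    by (intro sum.reindex_bij_witness[where i = "\<lambda>i. (n + j - i) mod n"
      and j = "\<lambda>i. (n + j - i) mod n"]) auto
  also have "\<dots> = (\<Sum>k<n. g k) * l ^ j"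
    by (simp add: sum_distrib_right)
  also have "(\<Sum>k<n. g k) = g 0 + (\<Sum>k=1..<n. g k)"
    using j by (simp add: lessThan_atLeast0 sum.atLeast_Suc_lessThan)
  also have "\<dots> = a 0 + (\<Sum>k=1..<n. a k * l ^ (n - k))"
    by (simp add: g_def)
  finally show ?thesis .
qed

text \<open>The rows of \<open>F\<close> are left eigenvectors, so \<open>F * M = D * F\<close> with
  \<open>D\<close> diagonal. Taking determinants and cancelling \<open>det F\<close> gives the
  product of the eigenvalues.\<close>

lemma det_theta_circulant_roots:
  fixes l :: "nat \<Rightarrow> 'a::field_char_0"
  assumes n: "n \<ge> 1" and \<theta>: "\<theta> \<noteq> 0" and roots: "\<And>i. i < n \<Longrightarrow> l i ^ n = \<theta>"
    and inj: "inj_on l {..<n}"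
  shows "det (theta_circulant \<theta> n a) =
    (\<Prod>i<n. a 0 + (\<Sum>k=1..<n. a k * l i ^ (n - k)))"
proof -
  define h where "h i = a 0 + (\<Sum>k=1..<n. a k * l i ^ (n - k))" for i
  define M where "M = theta_circulant \<theta> n a"
  define F where "F = mat n n (\<lambda>(i, j). l i ^ j)"
  define D where "D = mat n n (\<lambda>(i, j). if i = j then h i else 0)"
  have carrier: "M \<in> carrier_mat n n" "F \<in> carrier_mat n n" "D \<in> carrier_mat n n"
    by (auto simp: M_def theta_circulant_def F_def D_def)
  have "F * M = D * F"
  proof (rule eq_matI)
    fix i j assume "i < dim_row (D * F)" and "j < dim_col (D * F)"
    then have ij: "i < n" "j < n" by (auto simp: D_def F_def)
    have "(F * M) $$ (i, j) = (\<Sum>k<n. l i ^ k * theta_circulant \<theta> n a $$ (k, j))"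
      using ij carrier
      by (simp add: scalar_prod_def atLeast0LessThan) (simp add: F_def M_def)
    also have "\<dots> = h i * l i ^ j"
      using theta_circulant_left_eigenvector[OF ij(2) roots[OF ij(1)]] by (simp add: h_def)
    also have "\<dots> = (\<Sum>k<n. (if i = k then h i else 0) * l k ^ j)"
      using ij by (simp add: if_distrib[of "\<lambda>u. u * _"] cong: if_cong)
    also have "\<dots> = (D * F) $$ (i, j)"
      using ij by (simp add: scalar_prod_def atLeast0LessThan D_def F_def)
    finally show "(F * M) $$ (i, j) = (D * F) $$ (i, j)" .
  qed (use carrier in auto)
  then have "det F * det M = det D * det F"
    using carrier by (metis det_mult)
  moreover have "det F \<noteq> 0"
    unfolding F_def by (rule det_vandermonde_roots_nonzero[OF n \<theta> roots inj])
  ultimately have "det M = det D" by simp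
  also have "\<dots> = prod_list (diag_mat D)"
    by (rule det_upper_triangular[OF _ carrier(3)]) (auto simp: D_def)
  also have "\<dots> = (\<Prod>i<n. h i)"
    by (simp add: prod_list_diag_prod D_def atLeast0LessThan)
  finally show ?thesis by (simp add: M_def h_def)
qed

lemma det_theta_circulant_0:
  fixes a :: "nat \<Rightarrow> 'a::comm_ring_1"
  shows "det (theta_circulant 0 n a) = a 0 ^ n"
proof -
  have "det (theta_circulant 0 n a) = prod_list (diag_mat (theta_circulant 0 n a))"
    by (rule det_lower_triangular[of n]) (auto simp: theta_circulant_def)
  also have "\<dots> = a 0 ^ n"
    by (simp add: prod_list_diag_prod theta_circulant_def circulant_def)
  finally show ?thesis .
qed

text \<open>Writing \<open>\<theta>\<close> as \<open>t ^ n\<close> covers both cases: for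
  \<open>t = 0\<close> the exponents \<open>n - k\<close> are positive, and every factor collapses
  to \<open>a 0\<close>.\<close>

lemma det_theta_circulant:
  assumes n: "n \<ge> 1" and e: "primitive_unity_root n e"
  shows "det (theta_circulant (t ^ n) n a) =
    (\<Prod>r\<in>{1..n}. a 0 + (\<Sum>k=1..<n. a k * (e ^ r * t) ^ (n - k)))"
proof (cases "t = 0")
  case True
  then show ?thesis using n by (simp add: power_0_left det_theta_circulant_0)
next
  case False
  have "(e ^ k * t) ^ n = t ^ n" for k
    by (simp only: power_mult_distrib primitive_unity_root_power_power[OF e] mult_1)
  \<comment> \<open>The shift by \<open>Suc\<close> matches matrix indices from 0 with exponents
    from 1 to \<open>n\<close>.\<close>
  moreover have "inj_on (\<lambda>i. e ^ Suc i * t) {..<n}"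
    using inj_onD[OF primitive_unity_root_inj[OF e]] False
    by (intro inj_onI) (metis Suc_inject Suc_le_eq atLeastAtMost_iff lessThan_iff le_add1
      mult_cancel_right plus_1_eq_Suc)
  ultimately have "det (theta_circulant (t ^ n) n a) =
      (\<Prod>i<n. a 0 + (\<Sum>k=1..<n. a k * (e ^ Suc i * t) ^ (n - k)))"
    using False n by (intro det_theta_circulant_roots) (auto simp del: power_Suc)
  then show ?thesis
    by (simp only: prod.atLeast1_atMost_eq One_nat_def)
qed

lemma some_nth_root_power:
  assumes "n \<ge> 1"
  shows "some_nth_root n x ^ n = x"
proof -
  have "\<exists>u. u ^ n = x"
  proof
    show "rcis (root n (cmod x)) (Arg x / n) ^ n = x"
      using assms by (simp add: DeMoivre2 rcis_cmod_Arg)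
  qed
  then show ?thesis unfolding some_nth_root_def by (rule someI_ex)
qed

theorem theorem4:
  fixes n :: nat and e x y z w :: complex
  assumes "n \<ge> 1"
    and "primitive_unity_root n e"
    and "w ^ n = z"
  shows "nval_poly n e z x y =
    det (theta_circulant y n
      (\<lambda>k. if k = 0 then w ^ n + (-1) ^ (n + 1) * x + y
           else of_nat (n choose k) * w ^ k))"
proof -
  note n = assms(1) and e = assms(2)
  define u v where "u = some_nth_root n (nval_inv n x)" and "v = some_nth_root n (nval_inv n y)"
  have u: "u ^ n = (-1) ^ n * x" and v: "v ^ n = (-1) ^ n * y"
    by (simp_all add: u_def v_def some_nth_root_power[OF n] nval_inv_def)
  \<comment> \<open>The sign in \<open>nval_inv\<close> makes \<open>- v\<close>, not
    \<open>v\<close>, the root of \<open>y\<close> to be used as \<open>t\<close>.\<close>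
  have vy: "(- v) ^ n = y"
    by (simp add: power_minus[of v] v mult.assoc[symmetric] power_mult_distrib[symmetric])
  note root = primitive_unity_root_power_power[OF e]
  define a where "a k = (if k = 0 then w ^ n + (-1) ^ (n + 1) * x + y
    else of_nat (n choose k) * w ^ k)" for k
  have eigenvalue: "a 0 + (\<Sum>k=1..<n. a k * (e ^ r * (- v)) ^ (n - k)) =
      (w - e ^ r * v) ^ n - u ^ n" for r
  proof -
    define l where "l = e ^ r * (- v)"
    have l: "l ^ n = y" by (simp only: l_def power_mult_distrib root vy mult_1)
    have "(w + l) ^ n = (\<Sum>k\<le>n. of_nat (n choose k) * w ^ k * l ^ (n - k))"
      by (rule binomial_ring)
    \<comment> \<open>The two outer binomial terms are \<open>l ^ n = y\<close> and
      \<open>w ^ n\<close>; both are supplied by \<open>a 0\<close>, whose remaining summand is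
      \<open>- (u ^ n)\<close>.\<close>
    also have "{..n} = insert 0 (insert n {1..<n})" using n by auto
    also have "(\<Sum>k\<in>insert 0 (insert n {1..<n}). of_nat (n choose k) * w ^ k * l ^ (n - k)) =
        l ^ n + (w ^ n + (\<Sum>k=1..<n. of_nat (n choose k) * w ^ k * l ^ (n - k)))"
      using n by simp
    finally have "(w + l) ^ n = l ^ n + w ^ n + (\<Sum>k=1..<n. a k * l ^ (n - k))"
      by (simp add: a_def)
    moreover have "w - e ^ r * v = w + l" by (simp add: l_def)
    moreover have "a 0 = w ^ n - u ^ n + l ^ n" by (simp add: a_def u l)
    ultimately show ?thesis unfolding l_def[symmetric] by (simp only:) simp
  qed
  have "nval_poly n e z x y = (\<Prod>r\<in>{1..n}. w ^ n - (u + e ^ r * v) ^ n)"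
    unfolding nval_poly_def nval_mult_def u_def[symmetric] v_def[symmetric]
    by (simp add: assms(3) prod_unfold_prod_mset multiset.map_comp comp_def)
  also have "\<dots> = (\<Prod>r\<in>{1..n}. \<Prod>s\<in>{1..n}. w - e ^ s * (u + e ^ r * v))"
    by (simp only: power_diff_eq_prod_unity_roots[OF n e])
  \<comment> \<open>For fixed \<open>s\<close>, the product over \<open>r\<close> merges into a
    difference of \<open>n\<close>-th powers, in which \<open>(e ^ s) ^ n = 1\<close> removes the
    twist of \<open>v\<close>.\<close>
  also have "\<dots> = (\<Prod>s\<in>{1..n}. \<Prod>r\<in>{1..n}. (w - e ^ s * u) - e ^ r * (e ^ s * v))"
    by (subst prod.swap) (simp only: distrib_left diff_diff_eq mult.left_commute)
  also have "\<dots> = (\<Prod>s\<in>{1..n}. (w - e ^ s * u) ^ n - v ^ n)"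
    by (simp only: power_diff_eq_prod_unity_roots[OF n e, symmetric] power_mult_distrib root mult_1)
  also have "\<dots> = (\<Prod>s\<in>{1..n}. \<Prod>r\<in>{1..n}. (w - e ^ s * u) - e ^ r * v)"
    by (simp only: power_diff_eq_prod_unity_roots[OF n e])
  \<comment> \<open>The linear forms are now symmetric in \<open>u\<close> and \<open>v\<close>;
    merging over \<open>s\<close> instead yields the eigenvalues.\<close>
  also have "\<dots> = (\<Prod>r\<in>{1..n}. \<Prod>s\<in>{1..n}. (w - e ^ r * v) - e ^ s * u)"
    by (subst prod.swap) (intro prod.cong refl; simp)
  also have "\<dots> = (\<Prod>r\<in>{1..n}. (w - e ^ r * v) ^ n - u ^ n)"
    by (simp only: power_diff_eq_prod_unity_roots[OF n e])
  also have "\<dots> = det (theta_circulant y n a)"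
    using det_theta_circulant[OF n e, of "- v" a] by (simp only: eigenvalue vy)
  finally show ?thesis by (simp only: a_def[abs_def])
qed

end
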